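(* Consider the channel creation game with free fees, with $N>3$ nodes, blockchain fee $F_B>0$, and the homogeneous payment scenario with $k\ge1$ payments from every node to every other node. Let $c$ be an integer with $2\le c\le N/2$. Then no strategy combination in which $c$ nodes each open a channel to each of the other $N-c$ nodes, and no other channels are opened (so that the network is a complete bipartite graph with the smaller side creating the channels), is a Nash equilibrium, whatever fees the nodes choose on their channels.
   Context: Channel creation game with free fees. The players are the $N$ nodes. Fixed parameters: a blockchain fee $F_B\in\mathbb{R}$, $F_B>0$, and, for every ordered pair $(s,r)$ of distinct nodes, exactly $k$ transactions from $s$ to $r$ (homogeneous payment scenario). Strategies: simultaneously and with full information, each node $u$ chooses (i) a set $\mu_u$ of other nodes to which it opens channels, paying $F_B$ for each channel it opens, and (ii) a constant fee $f_u(v)\ge 0$ for each of its channels $\{u,v\}$ (formally, for every other node $v$; the value matters only if the channel $\{u,v\}$ exists). Channels are usable in both directions by everyone and have unlimited capital. The strategy combination determines an undirected graph with an edge $\{u,v\}$ whenever $u$ opens a channel to $v$ or $v$ to $u$. Transactions: a route of a transaction is a path $s=w_0,w_1,\dots,w_\ell=r$ in this graph from sender to receiver; each intermediate node $w_i$ ($1\le i\le \ell-1$) receives from the sender the fee $f_{w_i}(w_{i+1})$ for forwarding through its channel to $w_{i+1}$, and the cost of the route is the sum of these fees. If the cheapest route costs less than $F_B$, the transaction is executed along a cheapest route; if there are several, one is chosen uniformly at random and costs and revenues are taken in expectation. Otherwise the transaction is executed on-chain and the sender pays $F_B$. The cost of node $u$ is $|\mu_u|F_B$, plus the fees $u$ pays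 as sender (off-chain routing fees, and $F_B$ per on-chain transaction), minus the (expected) forwarding revenue of $u$. Each node wants to minimize its cost. A Nash equilibrium is a strategy combination in which no node can strictly decrease its cost by unilaterally changing its strategy. *)

theory Defs
  imports "HOL-Probability.Probability"
begin

text \<open>
  The players are the elements of a finite type \<open>'v\<close>, so \<open>N = CARD('v)\<close>.  Throughout, \<open>F\<close> is the
  blockchain fee and \<open>k\<close> the number of transactions for every ordered pair of distinct nodes.
\<close>

record 'v strategy =
  channels :: "'v set"
  fee :: "'v \<Rightarrow> real"

text \<open>The value \<open>fee x u\<close> of a strategy \<open>x\<close> of \<open>u\<close> itself is irrelevant and unconstrained.\<close>

definition valid_strategy :: "'v \<Rightarrow> 'v strategy \<Rightarrow> bool" where
  "valid_strategy u x \<longleftrightarrow> u \<notin> channels x \<and> (\<forall>v. v \<noteq> u \<longrightarrow> 0 \<le> fee x v)"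

type_synonym 'v profile = "'v \<Rightarrow> 'v strategy"

definition strategy_combination :: "'v profile \<Rightarrow> bool" where
  "strategy_combination \<sigma> \<longleftrightarrow> (\<forall>u. valid_strategy u (\<sigma> u))"

definition adjacent :: "'v profile \<Rightarrow> 'v \<Rightarrow> 'v \<Rightarrow> bool" where
  "adjacent \<sigma> u v \<longleftrightarrow> v \<in> channels (\<sigma> u) \<or> u \<in> channels (\<sigma> v)"

text \<open>
  A route is a path, hence without repeated nodes; it is represented by its list of nodes
  \<open>w ! 0, \<dots>, w ! (length w - 1)\<close>, sender and receiver included.
\<close>

definition routes :: "'v profile \<Rightarrow> 'v \<Rightarrow> 'v \<Rightarrow> 'v list set" where
  "routes \<sigma> s r =
     {w. w \<noteq> [] \<and> hd w = s \<and> last w = r \<and> distinct w \<and> successively (adjacent \<sigma>) w}"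

definition route_cost :: "'v profile \<Rightarrow> 'v list \<Rightarrow> real" where
  "route_cost \<sigma> w = (\<Sum>i\<in>{1..<length w - 1}. fee (\<sigma> (w ! i)) (w ! (i + 1)))"

definition route_revenue :: "'v profile \<Rightarrow> 'v \<Rightarrow> 'v list \<Rightarrow> real" where
  "route_revenue \<sigma> u w =
     (\<Sum>i\<in>{i \<in> {1..<length w - 1}. w ! i = u}. fee (\<sigma> u) (w ! (i + 1)))"

definition cheapest_routes :: "'v profile \<Rightarrow> 'v \<Rightarrow> 'v \<Rightarrow> 'v list set" where
  "cheapest_routes \<sigma> s r = {w. is_arg_min (route_cost \<sigma>) (\<lambda>w. w \<in> routes \<sigma> s r) w}"

text \<open>False in particular if there is no route at all.\<close>

definition off_chain :: "real \<Rightarrow> 'v profile \<Rightarrow> 'v \<Rightarrow> 'v \<Rightarrow> bool" where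
  "off_chain F \<sigma> s r \<longleftrightarrow> (\<exists>w\<in>cheapest_routes \<sigma> s r. route_cost \<sigma> w < F)"

text \<open>
  There are finitely many routes, so \<open>pmf_of_set\<close> is the uniform distribution on the cheapest ones
  whenever a transaction is executed off-chain.
\<close>

definition payment :: "real \<Rightarrow> 'v profile \<Rightarrow> 'v \<Rightarrow> 'v \<Rightarrow> real" where
  "payment F \<sigma> s r =
     (if off_chain F \<sigma> s r
      then measure_pmf.expectation (pmf_of_set (cheapest_routes \<sigma> s r)) (route_cost \<sigma>)
      else F)"

definition revenue :: "real \<Rightarrow> 'v profile \<Rightarrow> 'v \<Rightarrow> 'v \<Rightarrow> 'v \<Rightarrow> real" where
  "revenue F \<sigma> u s r =
     (if off_chain F \<sigma> s r
      then measure_pmf.expectation (pmf_of_set (cheapest_routes \<sigma> s r)) (route_revenue \<sigma> u)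
      else 0)"

definition node_cost :: "real \<Rightarrow> nat \<Rightarrow> 'v::finite profile \<Rightarrow> 'v \<Rightarrow> real" where
  "node_cost F k \<sigma> u =
     real (card (channels (\<sigma> u))) * F
     + (\<Sum>r\<in>UNIV - {u}. real k * payment F \<sigma> u r)
     - (\<Sum>(s, r)\<in>{(s, r). s \<noteq> r}. real k * revenue F \<sigma> u s r)"

definition nash_equilibrium :: "real \<Rightarrow> nat \<Rightarrow> 'v::finite profile \<Rightarrow> bool" where
  "nash_equilibrium F k \<sigma> \<longleftrightarrow>
     strategy_combination \<sigma> \<and>
     (\<forall>u x. valid_strategy u x \<longrightarrow> \<not> node_cost F k (\<sigma>(u := x)) u < node_cost F k \<sigma> u)"

end

theory Submission imports Defs begin

text \<open>
  Fix one side \<open>X\<close> of the bipartite graph.  The last forwarder of a transaction between two nodes of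
  \<open>X\<close> lies on the other side, and a cheapest route consists of a cheapest last forwarder and
  otherwise free hops, so it costs the least fee that a node of \<open>- X\<close> asks for the receiver.  As in
  Bertrand competition, a node \<open>u \<notin> X\<close> can attract all these transactions by asking for each
  receiver slightly less than the least fee of its competitors (or than \<open>F\<close>).  In an equilibrium its
  revenue is therefore at least the sum of these competing prices; summing over all \<open>u \<notin> X\<close>, while the
  senders pay only the overall least prices, forces all competing prices to be \<open>0\<close>.  Hence each node
  can be reached for free in at least two ways, all payments and revenues vanish, and a creator of
  channels can drop one of them without incurring any new fee.
\<close>

section \<open>Routes, payments and revenues\<close>

lemma finite_routes: "finite (routes \<sigma> s (r :: 'v::finite))"
  by (rule finite_subset[OF _ finite_subset_distinct[of "UNIV :: 'v set"]]) (auto simp: routes_def)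

lemma cheapest_routes_iff:
  "w \<in> cheapest_routes \<sigma> s r \<longleftrightarrow>
     w \<in> routes \<sigma> s r \<and> (\<forall>w'\<in>routes \<sigma> s r. route_cost \<sigma> w \<le> route_cost \<sigma> w')"
  by (auto simp: cheapest_routes_def is_arg_min_linorder)

lemma finite_cheapest_routes: "finite (cheapest_routes \<sigma> s (r :: 'v::finite))"
  by (rule finite_subset[OF _ finite_routes]) (auto simp: cheapest_routes_iff)

lemma ex_cheapest_route:
  assumes "w \<in> routes \<sigma> s (r :: 'v::finite)"
  obtains w' where "w' \<in> cheapest_routes \<sigma> s r"
  using ex_is_arg_min_if_finite[OF finite_routes, of \<sigma> s r "route_cost \<sigma>"] assms
  by (auto simp: cheapest_routes_def)

lemma off_chain_iff:
  assumes "w \<in> cheapest_routes \<sigma> s r"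
  shows "off_chain F \<sigma> s r \<longleftrightarrow> route_cost \<sigma> w < F"
  using assms by (fastforce simp: off_chain_def cheapest_routes_iff)

lemma off_chain_expectation:
  fixes g :: "'v::finite list \<Rightarrow> real"
  assumes "off_chain F \<sigma> s r"
  shows "measure_pmf.expectation (pmf_of_set (cheapest_routes \<sigma> s r)) g =
           (\<Sum>w\<in>cheapest_routes \<sigma> s r. g w) / real (card (cheapest_routes \<sigma> s r))"
    and "card (cheapest_routes \<sigma> s r) > 0"
proof -
  have "cheapest_routes \<sigma> s r \<noteq> {}"
    using assms by (auto simp: off_chain_def)
  then show "measure_pmf.expectation (pmf_of_set (cheapest_routes \<sigma> s r)) g =
           (\<Sum>w\<in>cheapest_routes \<sigma> s r. g w) / real (card (cheapest_routes \<sigma> s r))"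
    and "card (cheapest_routes \<sigma> s r) > 0"
    by (auto simp: integral_pmf_of_set finite_cheapest_routes card_gt_0_iff)
qed

lemma off_chain_expectation_mono:
  fixes g h :: "'v::finite list \<Rightarrow> real"
  assumes "off_chain F \<sigma> s r" and "\<And>w. w \<in> cheapest_routes \<sigma> s r \<Longrightarrow> g w \<le> h w"
  shows "measure_pmf.expectation (pmf_of_set (cheapest_routes \<sigma> s r)) g
           \<le> measure_pmf.expectation (pmf_of_set (cheapest_routes \<sigma> s r)) h"
  unfolding off_chain_expectation(1)[OF assms(1)]
  by (intro divide_right_mono sum_mono assms(2)) auto

text \<open>All cheapest routes share one cost, so the expectation is that cost; the minimum with
  \<open>F\<close> merges the off-chain and the on-chain case.\<close>

lemma payment_cheapest:
  fixes \<sigma> :: "'v::finite profile"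
  assumes w: "w \<in> cheapest_routes \<sigma> s r"
  shows "payment F \<sigma> s r = min F (route_cost \<sigma> w)"
proof (cases "off_chain F \<sigma> s r")
  case True
  have "route_cost \<sigma> w' = route_cost \<sigma> w" if "w' \<in> cheapest_routes \<sigma> s r" for w'
    using that w by (intro antisym) (auto simp: cheapest_routes_iff)
  then have "payment F \<sigma> s r = route_cost \<sigma> w"
    using off_chain_expectation(2)[OF True]
    by (simp add: payment_def True off_chain_expectation(1)[OF True])
  then show ?thesis
    using True off_chain_iff[OF w] by simp
next
  case False
  then show ?thesis
    using off_chain_iff[OF w] by (simp add: payment_def)
qed

lemma payment_le_route_cost:
  fixes \<sigma> :: "'v::finite profile"
  assumes "w \<in> routes \<sigma> s r"
  shows "payment F \<sigma> s r \<le> route_cost \<sigma> w"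
proof -
  obtain w' where w': "w' \<in> cheapest_routes \<sigma> s r"
    using assms by (rule ex_cheapest_route)
  then show ?thesis
    using assms payment_cheapest[OF w', of F] by (force simp: cheapest_routes_iff)
qed

lemma fee_nonneg:
  assumes "strategy_combination \<sigma>" and "u \<noteq> v"
  shows "0 \<le> fee (\<sigma> u) v"
  using assms by (auto simp: strategy_combination_def valid_strategy_def)

lemma hop_fee_nonneg:
  assumes "strategy_combination \<sigma>" and "w \<in> routes \<sigma> s r" and "i \<in> {1..<length w - 1}"
  shows "0 \<le> fee (\<sigma> (w ! i)) (w ! (i + 1))"
proof (rule fee_nonneg[OF assms(1)])
  show "w ! i \<noteq> w ! (i + 1)"
    using assms(2,3) by (auto simp: routes_def nth_eq_iff_index_eq)
qed

lemma route_cost_nonneg: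
  assumes "strategy_combination \<sigma>" and "w \<in> routes \<sigma> s r"
  shows "0 \<le> route_cost \<sigma> w"
  unfolding route_cost_def by (intro sum_nonneg hop_fee_nonneg[OF assms])

text \<open>With the fee written through \<open>w ! i\<close> instead of \<open>u\<close>, the
  revenue is a sub-sum of \<open>route_cost\<close>, so nonnegativity of hops and regrouping by
  forwarder apply directly.\<close>

lemma route_revenue_eq:
  "route_revenue \<sigma> u w =
     (\<Sum>i\<in>{i \<in> {1..<length w - 1}. w ! i = u}. fee (\<sigma> (w ! i)) (w ! (i + 1)))"
  by (auto simp: route_revenue_def intro: sum.cong)

lemma route_revenue_nonneg:
  assumes "strategy_combination \<sigma>" and "w \<in> routes \<sigma> s r"
  shows "0 \<le> route_revenue \<sigma> u w"
  unfolding route_revenue_eq by (intro sum_nonneg hop_fee_nonneg[OF assms]) auto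

lemma sum_route_revenue:
  "(\<Sum>u\<in>UNIV. route_revenue \<sigma> u w) = route_cost (\<sigma> :: 'v::finite profile) w"
  unfolding route_revenue_eq route_cost_def by (rule sum.group) auto

lemma revenue_nonneg:
  fixes \<sigma> :: "'v::finite profile"
  assumes "strategy_combination \<sigma>"
  shows "0 \<le> revenue F \<sigma> u s r"
proof (cases "off_chain F \<sigma> s r")
  case True
  have "measure_pmf.expectation (pmf_of_set (cheapest_routes \<sigma> s r)) (\<lambda>_. 0)
      \<le> revenue F \<sigma> u s r"
    unfolding revenue_def if_P[OF True]
    by (rule off_chain_expectation_mono[OF True])
       (auto simp: cheapest_routes_iff intro: route_revenue_nonneg[OF assms])
  then show ?thesis
    by simp
qed (simp add: revenue_def)

text \<open>Off-chain, the forwarders together receive exactly what the sender pays; on-chain, the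
  sender pays \<open>F\<close> and no node earns anything. Restricting to \<open>A\<close> only
  drops nonnegative revenues.\<close>

lemma sum_revenue_le_payment:
  fixes \<sigma> :: "'v::finite profile"
  assumes "strategy_combination \<sigma>" and "0 \<le> F"
  shows "(\<Sum>u\<in>A. revenue F \<sigma> u s r) \<le> payment F \<sigma> s r"
proof -
  have "(\<Sum>u\<in>A. revenue F \<sigma> u s r) \<le> (\<Sum>u\<in>UNIV. revenue F \<sigma> u s r)"
    by (rule sum_mono2) (auto intro: revenue_nonneg[OF assms(1)])
  also have "\<dots> \<le> payment F \<sigma> s r"
  proof (cases "off_chain F \<sigma> s r")
    case True
    show ?thesis
      unfolding revenue_def payment_def if_P[OF True] off_chain_expectation(1)[OF True]
      by (simp add: sum.swap[of _ _ UNIV] sum_route_revenue flip: sum_divide_distrib)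
  qed (use assms(2) in \<open>simp add: revenue_def payment_def\<close>)
  finally show ?thesis .
qed

lemma revenue_le_payment:
  fixes \<sigma> :: "'v::finite profile"
  assumes "strategy_combination \<sigma>" and "0 \<le> F"
  shows "revenue F \<sigma> u s r \<le> payment F \<sigma> s r"
  using sum_revenue_le_payment[OF assms, where A = "{u}"] by simp

section \<open>Complete bipartite graphs\<close>

definition bipartite :: "'v set \<Rightarrow> 'v profile \<Rightarrow> bool" where
  "bipartite X \<sigma> \<longleftrightarrow> (\<forall>u v. adjacent \<sigma> u v \<longleftrightarrow> (u \<in> X) \<noteq> (v \<in> X))"

lemma bipartite_compl: "bipartite (- X) \<sigma> \<longleftrightarrow> bipartite X \<sigma>"
  by (auto simp: bipartite_def)

text \<open>The fee \<open>F\<close> is included because on-chain execution caps the price.\<close>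

definition price :: "real \<Rightarrow> 'v profile \<Rightarrow> 'v set \<Rightarrow> 'v \<Rightarrow> real" where
  "price F \<sigma> A r = Min (insert F ((\<lambda>v. fee (\<sigma> v) r) ` A))"

lemma price_le_fee: "v \<in> A \<Longrightarrow> price F \<sigma> A r \<le> fee (\<sigma> v) (r :: 'v::finite)"
  by (auto simp: price_def intro: Min_le)

lemma price_le: "price F \<sigma> A (r :: 'v::finite) \<le> F"
  by (auto simp: price_def intro: Min_le)

lemma le_price_iff:
  "x \<le> price F \<sigma> A (r :: 'v::finite) \<longleftrightarrow> x \<le> F \<and> (\<forall>v\<in>A. x \<le> fee (\<sigma> v) r)"
  by (auto simp: price_def)

lemma price_antimono: "A \<subseteq> B \<Longrightarrow> price F \<sigma> B r \<le> price F \<sigma> A (r :: 'v::finite)"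
  by (auto simp: le_price_iff price_le intro: price_le_fee)

lemma price_nonneg:
  assumes "strategy_combination \<sigma>" and "0 \<le> F" and "(r :: 'v::finite) \<notin> A"
  shows "0 \<le> price F \<sigma> A r"
  using assms by (auto simp: le_price_iff intro!: fee_nonneg)

lemma price_cong:
  "(\<And>v. v \<in> A \<Longrightarrow> fee (\<sigma> v) r = fee (\<tau> v) r) \<Longrightarrow> price F \<sigma> A r = price F \<tau> A r"
  by (simp add: price_def)

text \<open>The minimum is attained, and not by the cap \<open>F\<close>.\<close>

lemma price_eq_0D:
  assumes "price F \<sigma> A (r :: 'v::finite) = 0" and "F \<noteq> 0"
  shows "\<exists>v\<in>A. fee (\<sigma> v) r = 0"
proof -
  have "price F \<sigma> A r \<in> insert F ((\<lambda>v. fee (\<sigma> v) r) ` A)"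
    unfolding price_def by (rule Min_in) auto
  then show ?thesis
    using assms by auto
qed

lemma two_hop_route:
  assumes "bipartite X \<sigma>" and "s \<in> X" and "r \<in> X" and "s \<noteq> r" and "t \<notin> X"
  shows "[s, t, r] \<in> routes \<sigma> s r" and "route_cost \<sigma> [s, t, r] = fee (\<sigma> t) r"
  using assms by (auto simp: routes_def bipartite_def route_cost_def)

text \<open>The node before the receiver is adjacent to it and hence outside \<open>X\<close>. The
  sender lies in \<open>X\<close>, so this node is a genuine intermediate node, whose fee counts in
  the route cost.\<close>

lemma last_forwarder:
  assumes "bipartite X \<sigma>" and "s \<in> X" and "r \<in> X" and "s \<noteq> r" and "w \<in> routes \<sigma> s r"
  obtains j where "j \<in> {1..<length w - 1}" and "w ! j \<notin> X" and "w ! (j + 1) = r"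
proof -
  define j where "j = length w - 2"
  have w: "w \<noteq> []" "hd w = s" "last w = r" "successively (adjacent \<sigma>) w"
    using assms(5) by (auto simp: routes_def)
  have len: "length w \<noteq> 1"
    using w assms(4) by (cases w) auto
  then have len2: "length w \<ge> 2"
    using w(1) by (cases w) (auto simp: Suc_le_eq)
  have j: "Suc j = length w - 1"
    using len2 by (auto simp: j_def)
  have r: "w ! (j + 1) = r"
    using w(1,3) j by (simp add: last_conv_nth)
  have "adjacent \<sigma> (w ! j) (w ! (j + 1))"
    using w(4) len2 by (simp add: successively_conv_nth j_def)
  then have notin: "w ! j \<notin> X"
    using assms(1,3) r by (auto simp: bipartite_def)
  moreover have "w ! 0 = s"
    using w(1,2) by (simp add: hd_conv_nth)
  ultimately have "j \<noteq> 0"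
    using assms(2) by metis
  then show ?thesis
    using that[of j] notin r j by auto
qed

text \<open>The last forwarder's fee alone bounds the cost of a route from below by the price, as
  all other hops are nonnegative. The two-hop routes through the nodes of \<open>- X\<close> give
  the upper bound.\<close>

lemma payment_bipartite:
  fixes \<sigma> :: "'v::finite profile"
  assumes \<sigma>: "strategy_combination \<sigma>" and bip: "bipartite X \<sigma>"
    and s: "s \<in> X" and r: "r \<in> X" and "s \<noteq> r" and "- X \<noteq> {}"
  shows "payment F \<sigma> s r = price F \<sigma> (- X) r"
proof -
  note hop = two_hop_route[OF bip s r \<open>s \<noteq> r\<close>]
  obtain t where "t \<notin> X"
    using assms(6) by auto
  then obtain w where w: "w \<in> cheapest_routes \<sigma> s r"
    using ex_cheapest_route[OF hop(1)] by blast
  then have wr: "w \<in> routes \<sigma> s r"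
    by (simp add: cheapest_routes_iff)
  obtain j where j: "j \<in> {1..<length w - 1}" "w ! j \<notin> X" "w ! (j + 1) = r"
    using last_forwarder[OF bip s r \<open>s \<noteq> r\<close> wr] .
  have "fee (\<sigma> (w ! j)) (w ! (j + 1)) \<le> route_cost \<sigma> w"
    unfolding route_cost_def
    using j(1) hop_fee_nonneg[OF \<sigma> wr] by (intro member_le_sum) auto
  then have "price F \<sigma> (- X) r \<le> route_cost \<sigma> w"
    using price_le_fee[of "w ! j" "- X" F \<sigma> r] j by simp
  moreover have "route_cost \<sigma> w \<le> fee (\<sigma> v) r" if "v \<in> - X" for v
    using w hop[of v] that by (auto simp: cheapest_routes_iff)
  ultimately show ?thesis
    unfolding payment_cheapest[OF w]
    by (intro antisym) (auto simp: le_price_iff price_le min.coboundedI2)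
qed

lemma payment_adjacent:
  fixes \<sigma> :: "'v::finite profile"
  assumes "strategy_combination \<sigma>" and "0 \<le> F" and "adjacent \<sigma> s r" and "s \<noteq> r"
  shows "payment F \<sigma> s r = 0"
proof -
  have route: "[s, r] \<in> routes \<sigma> s r" "route_cost \<sigma> [s, r] = 0"
    using assms(3,4) by (auto simp: routes_def route_cost_def)
  obtain w where w: "w \<in> cheapest_routes \<sigma> s r"
    using route(1) by (rule ex_cheapest_route)
  then have "route_cost \<sigma> w = 0"
    using route route_cost_nonneg[OF assms(1), of w s r]
    by (intro antisym) (auto simp: cheapest_routes_iff)
  then show ?thesis
    using payment_cheapest[OF w, of F] assms(2) by simp
qed

lemma payment_nonneg:
  fixes \<sigma> :: "'v::finite profile"
  assumes "strategy_combination \<sigma>" and "0 \<le> F"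
  shows "0 \<le> payment F \<sigma> s r"
  \<comment> \<open>For the empty set of forwarders the bounded sum is 0.\<close>
  using sum_revenue_le_payment[OF assms, where A = "{}"] by simp

text \<open>The two-hop route through the last forwarder of a cheapest route costs just that
  forwarder's fee. All other hops are therefore free, and the last forwarder is not in
  \<open>X\<close>.\<close>

lemma revenue_same_side:
  fixes \<sigma> :: "'v::finite profile"
  assumes \<sigma>: "strategy_combination \<sigma>" and bip: "bipartite X \<sigma>"
    and s: "s \<in> X" and r: "r \<in> X" and "s \<noteq> r" and u: "u \<in> X"
  shows "revenue F \<sigma> u s r = 0"
proof (cases "off_chain F \<sigma> s r")
  case True
  have "route_revenue \<sigma> u w \<le> 0" if w: "w \<in> cheapest_routes \<sigma> s r" for w
  proof -
    have wr: "w \<in> routes \<sigma> s r"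
      using w by (simp add: cheapest_routes_iff)
    obtain j where j: "j \<in> {1..<length w - 1}" "w ! j \<notin> X" "w ! (j + 1) = r"
      using last_forwarder[OF bip s r \<open>s \<noteq> r\<close> wr] .
    let ?f = "\<lambda>i. fee (\<sigma> (w ! i)) (w ! (i + 1))"
    let ?I = "{i \<in> {1..<length w - 1}. w ! i = u}"
    have "?f j + route_revenue \<sigma> u w = sum ?f (insert j ?I)"
      unfolding route_revenue_eq using j(2) u by (subst sum.insert) auto
    also have "\<dots> \<le> route_cost \<sigma> w"
      unfolding route_cost_def using j(1) hop_fee_nonneg[OF \<sigma> wr] by (intro sum_mono2) auto
    also have "\<dots> \<le> ?f j"
      using w two_hop_route[OF bip s r \<open>s \<noteq> r\<close> j(2)] j(3) by (auto simp: cheapest_routes_iff)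
    finally show ?thesis
      by simp
  qed
  then have "revenue F \<sigma> u s r
      \<le> measure_pmf.expectation (pmf_of_set (cheapest_routes \<sigma> s r)) (\<lambda>_. 0)"
    unfolding revenue_def if_P[OF True] by (rule off_chain_expectation_mono[OF True])
  then show ?thesis
    using revenue_nonneg[OF \<sigma>, of F u s r] by simp
qed (simp add: revenue_def)

text \<open>The route through \<open>u\<close> alone beats every route with another last forwarder,
  and also on-chain execution because prices are capped by \<open>F\<close>. So each cheapest route
  ends with the hop from \<open>u\<close> to \<open>r\<close>, and \<open>u\<close> earns that fee
  with certainty.\<close>

lemma revenue_undercut:
  fixes \<sigma> :: "'v::finite profile"
  assumes \<sigma>: "strategy_combination \<sigma>" and bip: "bipartite X \<sigma>"
    and s: "s \<in> X" and r: "r \<in> X" and "s \<noteq> r" and u: "u \<notin> X"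
    and less: "fee (\<sigma> u) r < price F \<sigma> (- X - {u}) r"
  shows "fee (\<sigma> u) r \<le> revenue F \<sigma> u s r"
proof -
  note hop = two_hop_route[OF bip s r \<open>s \<noteq> r\<close> u]
  obtain w0 where w0: "w0 \<in> cheapest_routes \<sigma> s r"
    using hop(1) by (rule ex_cheapest_route)
  then have "route_cost \<sigma> w0 \<le> fee (\<sigma> u) r"
    using hop by (auto simp: cheapest_routes_iff)
  also have "\<dots> < F"
    using less price_le by (rule less_le_trans)
  finally have off: "off_chain F \<sigma> s r"
    using off_chain_iff[OF w0] by simp
  have "fee (\<sigma> u) r \<le> route_revenue \<sigma> u w" if w: "w \<in> cheapest_routes \<sigma> s r" for w
  proof -
    have wr: "w \<in> routes \<sigma> s r"
      using w by (simp add: cheapest_routes_iff)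
    obtain j where j: "j \<in> {1..<length w - 1}" "w ! j \<notin> X" "w ! (j + 1) = r"
      using last_forwarder[OF bip s r \<open>s \<noteq> r\<close> wr] .
    let ?f = "\<lambda>i. fee (\<sigma> (w ! i)) (w ! (i + 1))"
    have "?f j \<le> route_cost \<sigma> w"
      unfolding route_cost_def
      using j(1) hop_fee_nonneg[OF \<sigma> wr] by (intro member_le_sum) auto
    also have "\<dots> \<le> fee (\<sigma> u) r"
      using w hop by (auto simp: cheapest_routes_iff)
    finally have "w ! j = u"
      using less price_le_fee[of "w ! j" "- X - {u}" F \<sigma> r] j by fastforce
    moreover have "?f j \<le> route_revenue \<sigma> u w"
      unfolding route_revenue_eq
    proof (rule member_le_sum)
      show "0 \<le> ?f i" if "i \<in> {i \<in> {1..<length w - 1}. w ! i = u} - {j}" for i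
        using that by (intro hop_fee_nonneg[OF \<sigma> wr]) simp
    qed (use j(1) \<open>w ! j = u\<close> in auto)
    ultimately show ?thesis
      using j(3) by simp
  qed
  then have "measure_pmf.expectation (pmf_of_set (cheapest_routes \<sigma> s r)) (\<lambda>_. fee (\<sigma> u) r)
      \<le> revenue F \<sigma> u s r"
    unfolding revenue_def if_P[OF off] by (rule off_chain_expectation_mono[OF off])
  then show ?thesis
    by simp
qed

section \<open>Competing prices vanish in equilibrium\<close>

text \<open>Undercutting: if \<open>u\<close> asks \<open>z\<close> times the competing price for
  each receiver in \<open>X\<close>, it earns at least this amount on every pair in \<open>P\<close>
  while its payments stay the same. Strictness needs \<open>z < 1\<close>; letting \<open>z\<close>
  tend to 1 gives the bound.\<close>

lemma equilibrium_revenue_ge: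
  fixes \<sigma> :: "'v::finite profile"
  assumes nash: "nash_equilibrium F k \<sigma>" and bip: "bipartite X \<sigma>" and F: "F > 0" and k: "k \<ge> 1"
    and u: "u \<notin> X" and "X \<noteq> {}"
  defines "P \<equiv> {(s, r). s \<in> X \<and> r \<in> X \<and> s \<noteq> r}"
  shows "(\<Sum>(s, r)\<in>P. price F \<sigma> (- X - {u}) r) \<le> (\<Sum>(s, r)\<in>P. revenue F \<sigma> u s r)"
proof (rule field_le_mult_one_interval)
  fix z :: real
  assume z: "0 < z" "z < 1"
  let ?q = "price F \<sigma> (- X - {u})"
  define x where "x = \<sigma> u\<lparr>fee := \<lambda>r. if r \<in> X then z * ?q r else fee (\<sigma> u) r\<rparr>"
  define \<tau> where "\<tau> = \<sigma>(u := x)"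
  have \<sigma>: "strategy_combination \<sigma>"
    using nash by (simp add: nash_equilibrium_def)
  have q: "0 \<le> ?q r" if "r \<in> X" for r
    using that F by (intro price_nonneg[OF \<sigma>]) auto
  have valid: "valid_strategy u x"
    using \<sigma> q z by (auto simp: valid_strategy_def strategy_combination_def x_def)
  then have \<tau>: "strategy_combination \<tau>"
    using \<sigma> by (auto simp: strategy_combination_def \<tau>_def)
  have "channels (\<tau> v) = channels (\<sigma> v)" for v
    by (simp add: \<tau>_def x_def)
  then have adj: "adjacent \<tau> = adjacent \<sigma>" and card: "card (channels (\<tau> u)) = card (channels (\<sigma> u))"
    by (auto simp: adjacent_def fun_eq_iff)
  then have bip': "bipartite X \<tau>"
    using bip by (simp add: bipartite_def)
  \<comment> \<open>Neighbours are paid for free, and payments to nodes on the side of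
    \<open>u\<close> depend only on fees set in \<open>X\<close>, which the deviation leaves
    alone.\<close>
  have pay: "payment F \<tau> u r = payment F \<sigma> u r" if "r \<noteq> u" for r
  proof (cases "r \<in> X")
    case True
    then have "adjacent \<sigma> u r"
      using bip u by (auto simp: bipartite_def)
    then show ?thesis
      using payment_adjacent[OF \<sigma>] payment_adjacent[OF \<tau>] adj F that by simp
  next
    case False
    have "price F \<tau> X r = price F \<sigma> X r"
      using u by (intro price_cong) (auto simp: \<tau>_def)
    then show ?thesis
      using payment_bipartite[of _ "- X" u r F] \<sigma> \<tau> bip bip' u False \<open>X \<noteq> {}\<close> that
      by (simp add: bipartite_compl)
  qed
  have "node_cost F k \<sigma> u \<le> node_cost F k \<tau> u"
    using nash valid by (auto simp: nash_equilibrium_def \<tau>_def not_less)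
  then have "(\<Sum>(s, r)\<in>{(s, r). s \<noteq> r}. real k * revenue F \<tau> u s r)
      \<le> (\<Sum>(s, r)\<in>{(s, r). s \<noteq> r}. real k * revenue F \<sigma> u s r)"
    using pay by (simp add: node_cost_def card)
  then have total: "(\<Sum>(s, r)\<in>{(s, r). s \<noteq> r}. revenue F \<tau> u s r)
      \<le> (\<Sum>(s, r)\<in>{(s, r). s \<noteq> r}. revenue F \<sigma> u s r)"
    using k by (simp add: case_prod_unfold flip: sum_distrib_left)
  have "z * (\<Sum>(s, r)\<in>P. ?q r) = (\<Sum>(s, r)\<in>P. z * ?q r)"
    by (simp add: sum_distrib_left case_prod_unfold)
  also have "\<dots> \<le> (\<Sum>(s, r)\<in>P. revenue F \<tau> u s r)"
  proof (intro sum_mono, clarify)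
    fix s r
    assume "(s, r) \<in> P"
    then have sr: "s \<in> X" "r \<in> X" "s \<noteq> r"
      by (auto simp: P_def)
    have fee: "fee (\<tau> u) r = z * ?q r"
      using sr by (simp add: \<tau>_def x_def)
    have price: "price F \<tau> (- X - {u}) r = ?q r"
      by (intro price_cong) (auto simp: \<tau>_def)
    show "z * ?q r \<le> revenue F \<tau> u s r"
    \<comment> \<open>A price of 0 cannot be undercut strictly, but then nonnegative revenue is
      enough.\<close>
    proof (cases "?q r = 0")
      case True
      then show ?thesis
        using revenue_nonneg[OF \<tau>] by simp
    next
      case False
      then have "fee (\<tau> u) r < price F \<tau> (- X - {u}) r"
        using z q[OF sr(2)] unfolding fee price by simp
      then show ?thesis
        using revenue_undercut[OF \<tau> bip' sr u] fee by simp
    qed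
  qed
  also have "\<dots> \<le> (\<Sum>(s, r)\<in>{(s, r). s \<noteq> r}. revenue F \<tau> u s r)"
    by (rule sum_mono2) (auto simp: P_def intro: revenue_nonneg[OF \<tau>])
  also have "\<dots> \<le> (\<Sum>(s, r)\<in>{(s, r). s \<noteq> r}. revenue F \<sigma> u s r)"
    by (rule total)
  \<comment> \<open>In \<sigma>, node \<open>u\<close> earns nothing outside \<open>P\<close>:
    adjacent pairs pay nothing, and transactions within \<open>- X\<close> do not reward nodes of
    their own side.\<close>
  also have "\<dots> = (\<Sum>(s, r)\<in>P. revenue F \<sigma> u s r)"
  proof (rule sum.mono_neutral_right)
    show "\<forall>p\<in>{(s, r). s \<noteq> r} - P. (case p of (s, r) \<Rightarrow> revenue F \<sigma> u s r) = 0"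
    proof clarify
      fix s r
      assume sr: "(s, r) \<notin> P" "s \<noteq> r"
      show "revenue F \<sigma> u s r = 0"
      proof (cases "adjacent \<sigma> s r")
        case True
        then have "revenue F \<sigma> u s r \<le> 0"
          using revenue_le_payment[OF \<sigma>, of F u s r] payment_adjacent[OF \<sigma> _ True sr(2), of F] F
          by simp
        then show ?thesis
          using revenue_nonneg[OF \<sigma>, of F u s r] by simp
      next
        case False
        then have "s \<in> - X" "r \<in> - X"
          using sr bip by (auto simp: P_def bipartite_def)
        then show ?thesis
          using revenue_same_side[of \<sigma> "- X" s r u F] \<sigma> bip sr(2) u by (simp add: bipartite_compl)
      qed
    qed
  qed (auto simp: P_def)
  finally show "z * (\<Sum>(s, r)\<in>P. ?q r) \<le> (\<Sum>(s, r)\<in>P. revenue F \<sigma> u s r)" .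
qed

text \<open>Write p for the overall price and q(v) for the price without v. Since p \<le> q(u') for
  a second node u', p + q(u) is at most the sum of all q(v). Summed over \<open>P\<close>, the
  latter is at most the total revenue, hence at most the payments, which sum to p over
  \<open>P\<close>. So q(u) sums to at most 0.\<close>

lemma equilibrium_price_eq_0:
  fixes \<sigma> :: "'v::finite profile"
  assumes nash: "nash_equilibrium F k \<sigma>" and bip: "bipartite X \<sigma>" and F: "F > 0" and k: "k \<ge> 1"
    and X: "card X \<ge> 2" and Y: "card (- X) \<ge> 2" and r: "r \<in> X" and u: "u \<notin> X"
  shows "price F \<sigma> (- X - {u}) r = 0"
proof -
  define P where "P = {(s, r). s \<in> X \<and> r \<in> X \<and> s \<noteq> r}"
  let ?q = "\<lambda>u. price F \<sigma> (- X - {u})"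
  have \<sigma>: "strategy_combination \<sigma>"
    using nash by (simp add: nash_equilibrium_def)
  have q: "0 \<le> ?q v r'" if "r' \<in> X" for v r'
    using that F by (intro price_nonneg[OF \<sigma>]) auto
  have "- X \<noteq> {u}" "X \<noteq> {r}" "X \<noteq> {}"
    using X Y by auto
  \<comment> \<open>The sender \<open>s\<close> ensures that the receiver \<open>r\<close> occurs in
    a pair of \<open>P\<close>.\<close>
  then obtain u' s where u': "u' \<in> - X" "u' \<noteq> u" and s: "s \<in> X" "s \<noteq> r"
    using r u by blast
  have "(\<Sum>(s, r)\<in>P. price F \<sigma> (- X) r + ?q u r) \<le> (\<Sum>(s, r)\<in>P. \<Sum>v\<in>- X. ?q v r)"
  proof (intro sum_mono, clarify)
    fix s' r'
    assume "(s', r') \<in> P"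
    then have "0 \<le> ?q v r'" for v
      by (intro q) (auto simp: P_def)
    then have "(\<Sum>v\<in>{u', u}. ?q v r') \<le> (\<Sum>v\<in>- X. ?q v r')"
      using u u' by (intro sum_mono2) auto
    moreover have "price F \<sigma> (- X) r' \<le> ?q u' r'"
      by (rule price_antimono) auto
    ultimately show "price F \<sigma> (- X) r' + ?q u r' \<le> (\<Sum>v\<in>- X. ?q v r')"
      using u' by simp
  qed
  also have "\<dots> = (\<Sum>v\<in>- X. \<Sum>(s, r)\<in>P. ?q v r)"
    unfolding case_prod_unfold by (rule sum.swap)
  also have "\<dots> \<le> (\<Sum>v\<in>- X. \<Sum>(s, r)\<in>P. revenue F \<sigma> v s r)"
    by (rule sum_mono) (use equilibrium_revenue_ge[OF nash bip F k _ \<open>X \<noteq> {}\<close>] in \<open>simp add: P_def\<close>)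
  also have "\<dots> = (\<Sum>(s, r)\<in>P. \<Sum>v\<in>- X. revenue F \<sigma> v s r)"
    unfolding case_prod_unfold by (rule sum.swap)
  also have "\<dots> \<le> (\<Sum>(s, r)\<in>P. price F \<sigma> (- X) r)"
  proof (intro sum_mono, clarify)
    fix s' r'
    assume "(s', r') \<in> P"
    then have "payment F \<sigma> s' r' = price F \<sigma> (- X) r'"
      using u' by (intro payment_bipartite[OF \<sigma> bip]) (auto simp: P_def)
    then show "(\<Sum>v\<in>- X. revenue F \<sigma> v s' r') \<le> price F \<sigma> (- X) r'"
      using sum_revenue_le_payment[OF \<sigma>, of F s' r' "- X"] F by simp
  qed
  finally have "(\<Sum>(s, r)\<in>P. ?q u r) \<le> 0"
    by (simp add: case_prod_unfold sum.distrib)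
  moreover have "(s, r) \<in> P"
    using s r by (simp add: P_def)
  then have "(case (s, r) of (s, r) \<Rightarrow> ?q u r) \<le> (\<Sum>(s, r)\<in>P. ?q u r)"
    by (rule member_le_sum) (auto simp: P_def intro: q)
  ultimately show ?thesis
    using q[OF r, of u] by simp
qed

section \<open>Dropping a channel\<close>

theorem theorem1:
  fixes F :: real and k c N :: nat
    and \<sigma> :: "'v::finite profile" and C :: "'v set"
  assumes "CARD('v) = N" and "N > 3"
    and "F > 0" and "k \<ge> 1"
    and "2 \<le> c" and "real c \<le> real N / 2"
    and "strategy_combination \<sigma>"
    and "card C = c"
    and "\<And>u. u \<in> C \<Longrightarrow> channels (\<sigma> u) = UNIV - C"
    and "\<And>u. u \<notin> C \<Longrightarrow> channels (\<sigma> u) = {}"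
  shows "\<not> nash_equilibrium F k \<sigma>"
proof
  assume nash: "nash_equilibrium F k \<sigma>"
  note F = \<open>F > 0\<close> and k = \<open>k \<ge> 1\<close> and \<sigma> = \<open>strategy_combination \<sigma>\<close>
  have bip: "bipartite C \<sigma>"
    using assms(9,10) unfolding bipartite_def adjacent_def by blast
  then have bip': "bipartite (- C) \<sigma>"
    by (simp add: bipartite_compl)
  have C: "card C \<ge> 2"
    using assms by simp
  \<comment> \<open>Here N - c \<ge> N/2 \<ge> c \<ge> 2.\<close>
  have D: "card (- C) \<ge> 2"
    using assms by (simp add: Compl_eq_Diff_UNIV card_Diff_subset)
  have q1: "price F \<sigma> (- C - {v}) r = 0" if "r \<in> C" "v \<in> - C" for r v
    using equilibrium_price_eq_0[OF nash bip F k C D] that by simp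
  have q2: "price F \<sigma> (C - {v}) r = 0" if "r \<in> - C" "v \<in> C" for r v
    using equilibrium_price_eq_0[OF nash bip' F k] C D that by simp
  \<comment> \<open>Whichever neighbour \<open>v\<close> is excluded, another one still forwards to
    \<open>r\<close> for free; this redundancy makes a single channel dispensable.\<close>
  have free1: "\<exists>t. t \<in> - C \<and> t \<noteq> v \<and> fee (\<sigma> t) r = 0" if "r \<in> C" "v \<in> - C" for r v
    using price_eq_0D[OF q1[OF that]] F by auto
  have free2: "\<exists>t. t \<in> C \<and> t \<noteq> v \<and> fee (\<sigma> t) r = 0" if "r \<in> - C" "v \<in> C" for r v
    using price_eq_0D[OF q2[OF that]] F by auto
  have "C \<noteq> {}" "- C \<noteq> {}"
    using C D by auto
  then obtain u d where u: "u \<in> C" and d: "d \<in> - C"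
    by blast

  \<comment> \<open>Since nothing is paid in \<sigma>, \<open>u\<close> has no revenue to lose, and
    its cost is at least that of its channels.\<close>
  have "payment F \<sigma> s r \<le> 0" if "s \<noteq> r" for s r
  proof -
    consider "adjacent \<sigma> s r" | "s \<in> C" "r \<in> C" | "s \<in> - C" "r \<in> - C"
      using bip by (auto simp: bipartite_def)
    then show ?thesis
    proof cases
      case 1
      then show ?thesis
        using payment_adjacent[OF \<sigma>] F that by simp
    next
      case 2
      have "payment F \<sigma> s r = price F \<sigma> (- C) r"
        using 2 that d by (intro payment_bipartite[OF \<sigma> bip]) auto
      also have "\<dots> \<le> price F \<sigma> (- C - {d}) r"
        by (rule price_antimono) auto
      finally show ?thesis
        using q1 2 d by simp
    next
      case 3
      have "payment F \<sigma> s r = price F \<sigma> (- (- C)) r"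
        using 3 that u by (intro payment_bipartite[OF \<sigma> bip']) auto
      also have "\<dots> \<le> price F \<sigma> (C - {u}) r"
        by (rule price_antimono) auto
      finally show ?thesis
        using q2 3 u by simp
    qed
  qed
  then have "revenue F \<sigma> u s r \<le> 0" if "s \<noteq> r" for s r
    using revenue_le_payment[OF \<sigma>, of F u s r] F that by fastforce
  then have "(\<Sum>(s, r)\<in>{(s, r). s \<noteq> r}. real k * revenue F \<sigma> u s r) \<le> 0"
    by (intro sum_nonpos) (auto simp: mult_nonneg_nonpos)
  moreover have "0 \<le> (\<Sum>r\<in>UNIV - {u}. real k * payment F \<sigma> u r)"
    using payment_nonneg[OF \<sigma>] F by (intro sum_nonneg) auto
  ultimately have before: "real (card (- C)) * F \<le> node_cost F k \<sigma> u"
    using assms(9)[OF u] by (simp add: node_cost_def Compl_eq_Diff_UNIV)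

  \<comment> \<open>The improving deviation: \<open>u\<close> drops its channel to \<open>d\<close>
    and keeps all its fees.\<close>
  define x where "x = \<sigma> u\<lparr>channels := - C - {d}\<rparr>"
  define \<tau> where "\<tau> = \<sigma>(u := x)"
  have valid: "valid_strategy u x"
    using \<sigma> u by (auto simp: strategy_combination_def valid_strategy_def x_def)
  then have \<tau>: "strategy_combination \<tau>"
    using \<sigma> by (auto simp: strategy_combination_def \<tau>_def)
  have fee: "fee (\<tau> v) = fee (\<sigma> v)" for v
    by (simp add: \<tau>_def x_def)
  have adj_u: "adjacent \<tau> u t" if "t \<in> - C" "t \<noteq> d" for t
    using that by (auto simp: adjacent_def \<tau>_def x_def)
  \<comment> \<open>Only the edge between \<open>u\<close> and \<open>d\<close> disappears. The
    edges listed here and in \<open>adj_u\<close> suffice to exhibit free routes from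
    \<open>u\<close>.\<close>
  have adj: "adjacent \<tau> a t" "adjacent \<tau> t a" if "t \<in> - C" "a \<in> C" "a \<noteq> u" for a t
    using that assms(9)[OF \<open>a \<in> C\<close>] by (auto simp: adjacent_def \<tau>_def)
  have "payment F \<tau> u r \<le> 0" if "r \<noteq> u" for r
  proof -
    consider "r \<in> C" | "r \<in> - C" "r \<noteq> d" | "r = d"
      by auto
    then show ?thesis
    proof cases
      case 1
      then obtain t where t: "t \<in> - C" "t \<noteq> d" "fee (\<sigma> t) r = 0"
        using free1 d by blast
      then have "[u, t, r] \<in> routes \<tau> u r" "route_cost \<tau> [u, t, r] = 0"
        using adj_u adj 1 that u by (auto simp: routes_def route_cost_def fee)
      then show ?thesis
        using payment_le_route_cost by fastforce
    next
      case 2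
      then show ?thesis
        using payment_adjacent[OF \<tau> _ adj_u[OF 2]] that F by simp
    next
      case 3
      \<comment> \<open>The lost neighbour \<open>d\<close> is reached by a detour of three hops:
        another creator \<open>a\<close> forwards to \<open>d\<close> for free, and some
        \<open>t\<close> other than \<open>d\<close> forwards to \<open>a\<close> for free.\<close>
      obtain a where a: "a \<in> C" "a \<noteq> u" "fee (\<sigma> a) d = 0"
        using free2 u d by blast
      obtain t where t: "t \<in> - C" "t \<noteq> d" "fee (\<sigma> t) a = 0"
        using free1 a d by blast
      have "[u, t, a, d] \<in> routes \<tau> u r"
        using adj_u adj a t u d 3 by (auto simp: routes_def)
      \<comment> \<open>The paid hops of the four-node route have indices 1 and 2: the fees of
        \<open>t\<close> and \<open>a\<close>.\<close>
      moreover have "{1..<3} = {1, 2 :: nat}"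
        by auto
      then have "route_cost \<tau> [u, t, a, d] = 0"
        using a t by (simp add: route_cost_def fee)
      ultimately show ?thesis
        using payment_le_route_cost by fastforce
    qed
  qed
  then have "(\<Sum>r\<in>UNIV - {u}. real k * payment F \<tau> u r) \<le> 0"
    by (intro sum_nonpos) (auto simp: mult_nonneg_nonpos)
  moreover have "0 \<le> (\<Sum>(s, r)\<in>{(s, r). s \<noteq> r}. real k * revenue F \<tau> u s r)"
    using revenue_nonneg[OF \<tau>] by (intro sum_nonneg) auto
  ultimately have after: "node_cost F k \<tau> u \<le> real (card (- C - {d})) * F"
    by (simp add: node_cost_def \<tau>_def x_def)
  \<comment> \<open>The deviation saves the full price \<open>F\<close> of one channel.\<close>
  have "real (card (- C - {d})) * F < real (card (- C)) * F"
    using F card_Diff1_less[OF _ d] by (intro mult_strict_right_mono) simp_all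
  then have "node_cost F k (\<sigma>(u := x)) u < node_cost F k \<sigma> u"
    using before after by (simp add: \<tau>_def)
  then show False
    using nash valid by (auto simp: nash_equilibrium_def)
qed

end
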